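(* Let $\mathbb{F}$ be a field of characteristic zero and let $\alpha\in\mathbb{F}$. (I) If $\alpha\neq\frac12$, then the automorphisms of $K_3(\alpha)$ are exactly the linear mappings $\phi$ given by $\phi(e)=e$, $\phi(z)=\gamma z$, $\phi(w)=\gamma^{-1}w$, where $\gamma\in\mathbb{F}$, $\gamma\neq0$. (II) If $\alpha=\frac12$, then the automorphisms of $K_3(\alpha)$ are exactly the linear mappings $\phi$ given by $\phi(e)=e$, $\phi(z)=\gamma_1z+\gamma_2w$, $\phi(w)=\gamma_3z+\gamma_4w$, where $\gamma_1,\gamma_2,\gamma_3,\gamma_4\in\mathbb{F}$ and $\gamma_1\gamma_4-\gamma_2\gamma_3=1$.
   Context: $K_3(\alpha)$ is the superalgebra over $\mathbb{F}$ with even part $\langle e\rangle$, odd part $\langle z,w\rangle$ (so $e,z,w$ is a basis) and multiplication $e^2=e$, $ez=\alpha z$, $ew=(1-\alpha)w$, $ze=(1-\alpha)z$, $we=\alpha w$, $z^2=0$, $zw=2\alpha e$, $wz=-2(1-\alpha)e$, $w^2=0$. An automorphism is a bijective linear map $\phi$ with $\phi(ab)=\phi(a)\phi(b)$ for all $a,b$. *)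

theory Defs
  imports "HOL-Analysis.Cartesian_Space"
begin

text \<open>
  The superalgebra \<open>K\<^sub>3(\<alpha>)\<close> lives on the coordinate space \<open>'f ^ 3\<close>, with the standard basis
  vectors playing the roles of \<open>e\<close>, \<open>z\<close>, \<open>w\<close>.
\<close>

definition k3_e :: "'f::field ^ 3" where "k3_e = axis 1 1"
definition k3_z :: "'f::field ^ 3" where "k3_z = axis 2 1"
definition k3_w :: "'f::field ^ 3" where "k3_w = axis 3 1"

definition k3_even :: "('f::field ^ 3) set" where "k3_even = vec.span {k3_e}"
definition k3_odd :: "('f::field ^ 3) set" where "k3_odd = vec.span {k3_z, k3_w}"

text \<open>Bilinear extension of the multiplication table; the products \<open>z\<^sup>2 = w\<^sup>2 = 0\<close> contribute nothing.\<close>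

definition k3_mult :: "'f::field \<Rightarrow> 'f ^ 3 \<Rightarrow> 'f ^ 3 \<Rightarrow> 'f ^ 3" where
  "k3_mult \<alpha> x y =
      (x $ 1 * y $ 1) *s k3_e
    + (x $ 1 * y $ 2) *s (\<alpha> *s k3_z)
    + (x $ 1 * y $ 3) *s ((1 - \<alpha>) *s k3_w)
    + (x $ 2 * y $ 1) *s ((1 - \<alpha>) *s k3_z)
    + (x $ 3 * y $ 1) *s (\<alpha> *s k3_w)
    + (x $ 2 * y $ 3) *s ((2 * \<alpha>) *s k3_e)
    + (x $ 3 * y $ 2) *s ((- 2 * (1 - \<alpha>)) *s k3_e)"

text \<open>Preservation of the grading is not part of the definition of an automorphism.\<close>

definition k3_automorphism :: "'f::field \<Rightarrow> ('f ^ 3 \<Rightarrow> 'f ^ 3) \<Rightarrow> bool" where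
  "k3_automorphism \<alpha> \<phi> \<longleftrightarrow>
     Vector_Spaces.linear (*s) (*s) \<phi> \<and> bij \<phi> \<and>
     (\<forall>a b. \<phi> (k3_mult \<alpha> a b) = k3_mult \<alpha> (\<phi> a) (\<phi> b))"

lemmas k3_basis_defs = k3_e_def k3_z_def k3_w_def

lemma k3_expand: "x = x $ 1 *s k3_e + x $ 2 *s k3_z + x $ 3 *s k3_w"
  by (simp add: vec_eq_iff forall_3 k3_basis_defs axis_def)

lemma k3_mult_table:
  "k3_mult \<alpha> k3_e k3_e = k3_e"
  "k3_mult \<alpha> k3_e k3_z = \<alpha> *s k3_z"
  "k3_mult \<alpha> k3_e k3_w = (1 - \<alpha>) *s k3_w"
  "k3_mult \<alpha> k3_z k3_e = (1 - \<alpha>) *s k3_z"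
  "k3_mult \<alpha> k3_w k3_e = \<alpha> *s k3_w"
  "k3_mult \<alpha> k3_z k3_z = 0"
  "k3_mult \<alpha> k3_z k3_w = (2 * \<alpha>) *s k3_e"
  "k3_mult \<alpha> k3_w k3_z = (- 2 * (1 - \<alpha>)) *s k3_e"
  "k3_mult \<alpha> k3_w k3_w = 0"
  by (simp_all add: vec_eq_iff forall_3 k3_mult_def k3_basis_defs axis_def)

lemma k3_mult_bilinear:
  "Vector_Spaces.linear (*s) (*s) (k3_mult \<alpha> x)"
  "Vector_Spaces.linear (*s) (*s) (\<lambda>x. k3_mult \<alpha> x y)"
  by (unfold_locales; simp add: vec_eq_iff forall_3 k3_mult_def k3_basis_defs axis_def algebra_simps)+

lemma k3_even_iff: "x \<in> k3_even \<longleftrightarrow> x $ 2 = 0 \<and> x $ 3 = 0"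
  by (auto simp: k3_even_def vec.span_singleton k3_basis_defs axis_def vec_eq_iff forall_3)

lemma k3_odd_iff: "x \<in> k3_odd \<longleftrightarrow> x $ 1 = 0"
proof -
  have "x \<in> k3_odd \<longleftrightarrow> (\<exists>k l. x = k *s k3_z + l *s k3_w)"
    by (auto simp: k3_odd_def vec.span_insert vec.span_singleton algebra_simps; metis add.commute diff_add_cancel)
  also have "\<dots> \<longleftrightarrow> x $ 1 = 0"
    by (auto simp: k3_basis_defs axis_def vec_eq_iff forall_3)
  finally show ?thesis .
qed

lemma k3_graded:
  "\<lbrakk>x \<in> k3_even; y \<in> k3_even\<rbrakk> \<Longrightarrow> k3_mult \<alpha> x y \<in> k3_even"
  "\<lbrakk>x \<in> k3_even; y \<in> k3_odd\<rbrakk> \<Longrightarrow> k3_mult \<alpha> x y \<in> k3_odd"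
  "\<lbrakk>x \<in> k3_odd; y \<in> k3_even\<rbrakk> \<Longrightarrow> k3_mult \<alpha> x y \<in> k3_odd"
  "\<lbrakk>x \<in> k3_odd; y \<in> k3_odd\<rbrakk> \<Longrightarrow> k3_mult \<alpha> x y \<in> k3_even"
  by (simp_all add: k3_even_iff k3_odd_iff k3_mult_def k3_basis_defs axis_def)

end

(* An automorphism is determined by u = \<phi> e, p = \<phi> z, q = \<phi> w, which satisfy the same
   multiplication table as e, z, w. Since u is a nonzero idempotent, its e-coordinate is 1.
   The difference of the e-coordinates of p q and q p shows that the odd parts of p and q have
   determinant 1, and the actions of u on p and q then force u = e and p, q odd; these odd parts
   are diagonal unless \<alpha> = 1/2. *)
theory Submission
  imports Defs
begin

lemma k3_mult_nth:
  "k3_mult \<alpha> x y $ 1 = x $ 1 * y $ 1 + 2 * \<alpha> * (x $ 2 * y $ 3) - 2 * (1 - \<alpha>) * (x $ 3 * y $ 2)"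
  "k3_mult \<alpha> x y $ 2 = \<alpha> * (x $ 1 * y $ 2) + (1 - \<alpha>) * (x $ 2 * y $ 1)"
  "k3_mult \<alpha> x y $ 3 = (1 - \<alpha>) * (x $ 1 * y $ 3) + \<alpha> * (x $ 3 * y $ 1)"
  by (simp_all add: k3_mult_def k3_basis_defs axis_def algebra_simps)

lemma k3_basis_nth [simp]:
  "k3_e $ 1 = 1" "k3_e $ 2 = 0" "k3_e $ 3 = 0"
  "k3_z $ 1 = 0" "k3_z $ 2 = 1" "k3_z $ 3 = 0"
  "k3_w $ 1 = 0" "k3_w $ 2 = 0" "k3_w $ 3 = 1"
  by (simp_all add: k3_basis_defs axis_def)

text \<open>Because \<alpha> and 1 - \<alpha> sum to 1, squaring multiplies both odd coordinates by
  \<open>u $ 1\<close>. If that scalar is not 1, the odd part of an idempotent vanishes, and the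
  remaining equation for \<open>u $ 1\<close> leaves only the root 0.\<close>

lemma k3_idempotent_nth_1:
  fixes u :: "'f::field ^ 3"
  assumes "k3_mult \<alpha> u u = u" "u \<noteq> 0"
  shows "u $ 1 = 1"
proof (rule ccontr)
  assume ne: "u $ 1 \<noteq> 1"
  have eqs: "k3_mult \<alpha> u u $ i = u $ i" for i
    using assms(1) by simp
  have "(u $ 1 - 1) * u $ 2 = 0" "(u $ 1 - 1) * u $ 3 = 0"
    using eqs[of 2] eqs[of 3] by (simp_all add: k3_mult_nth algebra_simps)
  then have u23: "u $ 2 = 0" "u $ 3 = 0"
    using ne by auto
  then have "(u $ 1 - 1) * u $ 1 = 0"
    using eqs[of 1] by (simp add: k3_mult_nth algebra_simps)
  then have "u = 0"
    using ne u23 by (simp add: vec_eq_iff forall_3)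
  then show False
    using assms(2) by simp
qed

lemma k3_relations_imp:
  fixes u p q :: "'f::field_char_0 ^ 3"
  assumes u1: "u $ 1 = 1"
    and up: "k3_mult \<alpha> u p = \<alpha> *s p" and pu: "k3_mult \<alpha> p u = (1 - \<alpha>) *s p"
    and uq: "k3_mult \<alpha> u q = (1 - \<alpha>) *s q" and qu: "k3_mult \<alpha> q u = \<alpha> *s q"
    and pq: "k3_mult \<alpha> p q = (2 * \<alpha>) *s u" and qp: "k3_mult \<alpha> q p = (- 2 * (1 - \<alpha>)) *s u"
  shows "u = k3_e" "p $ 1 = 0" "q $ 1 = 0" "p $ 2 * q $ 3 - p $ 3 * q $ 2 = 1"
    "\<alpha> \<noteq> 1 / 2 \<Longrightarrow> p $ 3 = 0 \<and> q $ 2 = 0"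
proof -
  define b c where "b = u $ 2" and "c = u $ 3"
  note nth = k3_mult_nth u1 vector_smult_component b_def[symmetric] c_def[symmetric]
  note up' = arg_cong[OF up, of "\<lambda>x. x $ 1", unfolded nth]
    arg_cong[OF up, of "\<lambda>x. x $ 2", unfolded nth] arg_cong[OF up, of "\<lambda>x. x $ 3", unfolded nth]
  note pu' = arg_cong[OF pu, of "\<lambda>x. x $ 1", unfolded nth]
    arg_cong[OF pu, of "\<lambda>x. x $ 2", unfolded nth] arg_cong[OF pu, of "\<lambda>x. x $ 3", unfolded nth]
  note uq' = arg_cong[OF uq, of "\<lambda>x. x $ 1", unfolded nth]
    arg_cong[OF uq, of "\<lambda>x. x $ 2", unfolded nth] arg_cong[OF uq, of "\<lambda>x. x $ 3", unfolded nth]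
  note qu' = arg_cong[OF qu, of "\<lambda>x. x $ 1", unfolded nth]
    arg_cong[OF qu, of "\<lambda>x. x $ 2", unfolded nth] arg_cong[OF qu, of "\<lambda>x. x $ 3", unfolded nth]
  \<comment> \<open>The coefficients 2 \<alpha> and - 2 (1 - \<alpha>) differ by 2, so subtraction
    gives twice the determinant on one side and 2 on the other; characteristic zero permits
    cancelling the 2.\<close>
  have "2 * (p $ 2 * q $ 3 - p $ 3 * q $ 2) = 2 * 1"
    using arg_cong[OF pq, of "\<lambda>x. x $ 1", unfolded nth] arg_cong[OF qp, of "\<lambda>x. x $ 1", unfolded nth]
    by algebra
  then show det: "p $ 2 * q $ 3 - p $ 3 * q $ 2 = 1"
    by (simp only: mult_cancel_left) simp
  \<comment> \<open>Add the two actions of \<open>u\<close> on \<open>p\<close>: the odd coordinates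
    of \<open>up + pu\<close> are those of \<open>p\<close> plus \<open>p $ 1\<close> times those of
    \<open>u\<close>, while the relations say that the sum is \<open>p\<close>. The same holds for
    \<open>q\<close>.\<close>
  have bp: "b * p $ 1 = 0" and cp: "c * p $ 1 = 0" and bq: "b * q $ 1 = 0" and cq: "c * q $ 1 = 0"
    using up'(2,3) pu'(2,3) uq'(2,3) qu'(2,3) by algebra+
  \<comment> \<open>Once the cross terms are gone, left multiplication by \<open>u\<close> scales
    the z- and w-coordinates by \<alpha> and 1 - \<alpha>; a coordinate scaled by the wrong
    eigenvalue is killed by 1 - 2 \<alpha>.\<close>
  have p3: "(1 - 2 * \<alpha>) * p $ 3 = 0" and q2: "(1 - 2 * \<alpha>) * q $ 2 = 0"
    using up'(3) cp uq'(2) bq by algebra+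
  \<comment> \<open>These are the e-coordinates of \<open>up + pu = p\<close> and
    \<open>uq + qu = q\<close>; \<open>p3\<close> and \<open>q2\<close> remove one of the two mixed
    terms.\<close>
  have p1: "p $ 1 = 2 * (1 - 2 * \<alpha>) * (c * p $ 2)" and q1: "q $ 1 = 2 * (1 - 2 * \<alpha>) * (b * q $ 3)"
    using up'(1) pu'(1) p3 uq'(1) qu'(1) q2 by algebra+
  show odd: "p $ 3 = 0 \<and> q $ 2 = 0" if "\<alpha> \<noteq> 1 / 2"
    using that p3 q2 by (auto simp: field_simps)
  have "b = 0 \<and> c = 0"
  proof (cases "\<alpha> = 1 / 2")
    case True
    then have "1 - 2 * \<alpha> = 0"
      by (simp add: field_simps)
    then have "p $ 1 = 0" "q $ 1 = 0"
      using p1 q1 by (simp_all only: mult_zero_left mult_zero_right)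
    \<comment> \<open>The odd part (b, c) of \<open>u\<close> is now parallel to the odd parts of
      both \<open>p\<close> and \<open>q\<close>, which are independent by \<open>det\<close>, so it
      vanishes.\<close>
    then have "b * p $ 3 = c * p $ 2" "b * q $ 3 = c * q $ 2"
      using up'(1) uq'(1) True by simp_all
    then have "b = 0" "c = 0"
      using det by algebra+
    then show ?thesis by simp
  next
    case False
    then have "2 * (1 - 2 * \<alpha>) \<noteq> 0"
      by (auto simp: field_simps)
    \<comment> \<open>Substituting \<open>p1\<close> into \<open>cp\<close> leaves an extra factor
      \<open>p $ 2\<close>. It is invertible, since \<open>det\<close> reduces to
      \<open>p $ 2 * q $ 3 = 1\<close> here; likewise for \<open>b\<close> with
      \<open>q $ 3\<close>.\<close>
    moreover have "2 * (1 - 2 * \<alpha>) * c ^ 2 = 0" "2 * (1 - 2 * \<alpha>) * b ^ 2 = 0"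
      using cp p1 bq q1 det odd[OF False] by algebra+
    ultimately show ?thesis
      by simp
  qed
  then show "u = k3_e" "p $ 1 = 0" "q $ 1 = 0"
    using u1 p1 q1 by (simp_all add: vec_eq_iff forall_3 b_def c_def)
qed

text \<open>Treating diagonality as a side condition for \<alpha> \<noteq> 1/2 puts both cases into
  one matrix family, so the two parts of the theorem are specializations.\<close>

lemma k3_automorphism_iff:
  fixes \<alpha> :: "'f::field_char_0"
  shows "k3_automorphism \<alpha> \<phi> \<longleftrightarrow>
    Vector_Spaces.linear (*s) (*s) \<phi> \<and>
    (\<exists>g1 g2 g3 g4. g1 * g4 - g2 * g3 = 1 \<and> (\<alpha> \<noteq> 1 / 2 \<longrightarrow> g2 = 0 \<and> g3 = 0) \<and>
      \<phi> k3_e = k3_e \<and> \<phi> k3_z = g1 *s k3_z + g2 *s k3_w \<and> \<phi> k3_w = g3 *s k3_z + g4 *s k3_w)"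
    (is "_ \<longleftrightarrow> ?R")
proof
  assume aut: "k3_automorphism \<alpha> \<phi>"
  then have lin: "Vector_Spaces.linear (*s) (*s) \<phi>" and inj: "inj \<phi>"
    and hom: "k3_mult \<alpha> (\<phi> a) (\<phi> b) = \<phi> (k3_mult \<alpha> a b)" for a b
    by (auto simp: k3_automorphism_def bij_def)
  interpret Vector_Spaces.linear "(*s)" "(*s)" \<phi> by (fact lin)
  have "k3_e \<noteq> (0 :: 'f ^ 3)"
    by (simp add: vec_eq_iff forall_3)
  then have "\<phi> k3_e \<noteq> 0"
    using inj zero by (metis injD)
  then have u1: "\<phi> k3_e $ 1 = 1"
    using k3_idempotent_nth_1 hom k3_mult_table(1) by metis
  \<comment> \<open>Rewriting products of images as images of products makes all six relations
    reflexive.\<close>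
  note rel = k3_relations_imp[of "\<phi> k3_e" \<alpha> "\<phi> k3_z" "\<phi> k3_w", OF u1,
      unfolded hom k3_mult_table scale, OF refl refl refl refl refl refl]
  have "\<phi> k3_z = \<phi> k3_z $ 2 *s k3_z + \<phi> k3_z $ 3 *s k3_w"
    "\<phi> k3_w = \<phi> k3_w $ 2 *s k3_z + \<phi> k3_w $ 3 *s k3_w"
    using rel(2,3) by (simp_all add: vec_eq_iff forall_3)
  then show ?R
    using lin rel by blast
next
  assume ?R
  then obtain g1 g2 g3 g4 where lin: "Vector_Spaces.linear (*s) (*s) \<phi>"
    and det: "g1 * g4 - g2 * g3 = 1" and diag: "\<alpha> \<noteq> 1 / 2 \<longrightarrow> g2 = 0 \<and> g3 = 0"
    and vals: "\<phi> k3_e = k3_e" "\<phi> k3_z = g1 *s k3_z + g2 *s k3_w" "\<phi> k3_w = g3 *s k3_z + g4 *s k3_w"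
    by blast
  interpret Vector_Spaces.linear "(*s)" "(*s)" \<phi> by (fact lin)
  have nth: "\<phi> x $ 1 = x $ 1" "\<phi> x $ 2 = g1 * x $ 2 + g3 * x $ 3"
    "\<phi> x $ 3 = g2 * x $ 2 + g4 * x $ 3" for x
  proof -
    have "\<phi> x = x $ 1 *s \<phi> k3_e + x $ 2 *s \<phi> k3_z + x $ 3 *s \<phi> k3_w"
      using k3_expand[of x] by (metis add scale)
    then show "\<phi> x $ 1 = x $ 1" "\<phi> x $ 2 = g1 * x $ 2 + g3 * x $ 3"
      "\<phi> x $ 3 = g2 * x $ 2 + g4 * x $ 3"
      by (simp_all add: vals algebra_simps)
  qed
  \<comment> \<open>On the odd coordinates the kernel equations form a 2 by 2 system of determinant
    1; in finite dimension, injectivity then yields bijectivity.\<close>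
  have "x = 0" if "\<phi> x = 0" for x
  proof -
    have "x $ 1 = 0" "g1 * x $ 2 + g3 * x $ 3 = 0" "g2 * x $ 2 + g4 * x $ 3 = 0"
      using nth[of x] that by simp_all
    moreover from this have "x $ 2 = 0" "x $ 3 = 0"
      using det by algebra+
    ultimately show ?thesis
      by (simp add: vec_eq_iff forall_3)
  qed
  then have "inj \<phi>"
    using vec.linear_inj_iff_eq_0[OF lin] by blast
  then have "bij \<phi>"
    using lin vec.linear_inj_imp_surj by (auto simp: bij_def)
  moreover have "\<phi> (k3_mult \<alpha> a b) = k3_mult \<alpha> (\<phi> a) (\<phi> b)" for a b
  proof -
    \<comment> \<open>These equations hold in both cases. Multiplicativity fails only by multiples
      of (1 - 2 \<alpha>) \<open>g2\<close>, (1 - 2 \<alpha>) \<open>g3\<close> and the determinant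
      minus 1, so no case split is needed.\<close>
    have gm: "(1 - 2 * \<alpha>) * g2 = 0" "(1 - 2 * \<alpha>) * g3 = 0"
      using diag by (auto simp: field_simps)
    have "\<phi> (k3_mult \<alpha> a b) $ 1 = k3_mult \<alpha> (\<phi> a) (\<phi> b) $ 1"
      "\<phi> (k3_mult \<alpha> a b) $ 2 = k3_mult \<alpha> (\<phi> a) (\<phi> b) $ 2"
      "\<phi> (k3_mult \<alpha> a b) $ 3 = k3_mult \<alpha> (\<phi> a) (\<phi> b) $ 3"
      unfolding nth k3_mult_nth using gm det by algebra+
    then show ?thesis
      by (simp add: vec_eq_iff forall_3)
  qed
  ultimately show "k3_automorphism \<alpha> \<phi>"
    using lin by (simp add: k3_automorphism_def)
qed

theorem mainTheorem5:
  fixes \<alpha> :: "'f::field_char_0"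
  shows
    "(\<alpha> \<noteq> 1 / 2 \<longrightarrow>
       (\<forall>\<phi> :: 'f ^ 3 \<Rightarrow> 'f ^ 3. k3_automorphism \<alpha> \<phi> \<longleftrightarrow>
          Vector_Spaces.linear (*s) (*s) \<phi> \<and>
          (\<exists>\<gamma>. \<gamma> \<noteq> 0 \<and>
             \<phi> k3_e = k3_e \<and> \<phi> k3_z = \<gamma> *s k3_z \<and> \<phi> k3_w = inverse \<gamma> *s k3_w)))
     \<and>
     (\<alpha> = 1 / 2 \<longrightarrow>
       (\<forall>\<phi> :: 'f ^ 3 \<Rightarrow> 'f ^ 3. k3_automorphism \<alpha> \<phi> \<longleftrightarrow>
          Vector_Spaces.linear (*s) (*s) \<phi> \<and>
          (\<exists>\<gamma>\<^sub>1 \<gamma>\<^sub>2 \<gamma>\<^sub>3 \<gamma>\<^sub>4. \<gamma>\<^sub>1 * \<gamma>\<^sub>4 - \<gamma>\<^sub>2 * \<gamma>\<^sub>3 = 1 \<and>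
             \<phi> k3_e = k3_e \<and>
             \<phi> k3_z = \<gamma>\<^sub>1 *s k3_z + \<gamma>\<^sub>2 *s k3_w \<and>
             \<phi> k3_w = \<gamma>\<^sub>3 *s k3_z + \<gamma>\<^sub>4 *s k3_w)))"
proof (intro conjI impI allI)
  fix \<phi> :: "'f ^ 3 \<Rightarrow> 'f ^ 3"
  assume \<alpha>: "\<alpha> \<noteq> 1 / 2"
  have "(\<exists>g1 g2 g3 g4. g1 * g4 - g2 * g3 = 1 \<and> (\<alpha> \<noteq> 1 / 2 \<longrightarrow> g2 = 0 \<and> g3 = 0) \<and>
      \<phi> k3_e = k3_e \<and> \<phi> k3_z = g1 *s k3_z + g2 *s k3_w \<and> \<phi> k3_w = g3 *s k3_z + g4 *s k3_w)
    \<longleftrightarrow> (\<exists>g1 g4. g1 * g4 = 1 \<and> \<phi> k3_e = k3_e \<and> \<phi> k3_z = g1 *s k3_z \<and> \<phi> k3_w = g4 *s k3_w)"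
    using \<alpha> by auto
  \<comment> \<open>Take \<gamma> = \<open>g1\<close>; the determinant condition has become
    \<open>g1 * g4 = 1\<close>, which makes \<open>g4\<close> its inverse.\<close>
  also have "\<dots> \<longleftrightarrow> (\<exists>\<gamma>. \<gamma> \<noteq> 0 \<and> \<phi> k3_e = k3_e \<and> \<phi> k3_z = \<gamma> *s k3_z \<and> \<phi> k3_w = inverse \<gamma> *s k3_w)"
    by (metis inverse_unique right_inverse mult_zero_left zero_neq_one)
  finally show "k3_automorphism \<alpha> \<phi> \<longleftrightarrow>
          Vector_Spaces.linear (*s) (*s) \<phi> \<and>
          (\<exists>\<gamma>. \<gamma> \<noteq> 0 \<and>
             \<phi> k3_e = k3_e \<and> \<phi> k3_z = \<gamma> *s k3_z \<and> \<phi> k3_w = inverse \<gamma> *s k3_w)"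
    unfolding k3_automorphism_iff by simp
qed (simp add: k3_automorphism_iff)

end
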